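(* For every integer $k\ge 0$, with $n=2^k$, $|CS(k)| \ge 2^{n}\left(1-\frac{1}{n/2}\right) = 2^{2^k}\left(1-\frac{1}{2^{k-1}}\right)$.
   Context: $\mu$ is the morphism on binary words with $\mu(0)=01$, $\mu(1)=10$; $\mu^n$ is its $n$-fold iterate. Words $CS(k)$, $k\ge 0$, are defined recursively: $CS(0)=0$ (the one-letter word). For $k\ge 1$, let $n=2^k$, $m=2^{k-1}$, $X=\mu^n(0)$, $Y=\mu^n(1)$, and write $X=x_0x_1\cdots x_{2^m-1}$, $Y=y_0y_1\cdots y_{2^m-1}$ as concatenations of $2^m$ consecutive blocks of length $2^m$ (each block is $\mu^m(0)$ or $\mu^m(1)$). For $0\le i<2^m-1$ define $cs_i=x_i$ if $i$ is even; if $i$ is odd, $cs_i=x_i$ when $x_i=y_{i+1}$ and $cs_i=CS(k-1)$ otherwise. Then $CS(k)=cs_0cs_1\cdots cs_{2^m-2}$, which is a common subsequence of $\mu^{2^k}(0)$ and $\mu^{2^k}(1)$; $|CS(k)|$ denotes its length. *)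

theory Defs
  imports Complex_Main
begin

text \<open>Binary words are lists of booleans, with \<^term>\<open>False\<close> for the letter 0 and
  \<^term>\<open>True\<close> for the letter 1.\<close>

type_synonym word = "bool list"

definition mu :: "word \<Rightarrow> word" where
  "mu w = concat (map (\<lambda>b. if b then [True, False] else [False, True]) w)"

text \<open>The \<open>i\<close>-th block, counted from 0, of a word cut into consecutive blocks of length \<open>l\<close>.\<close>

definition block :: "nat \<Rightarrow> word \<Rightarrow> nat \<Rightarrow> word" where
  "block l w i = take l (drop (i * l) w)"

text \<open>The word \<open>(mu ^^ n) [b]\<close> has length \<open>2 ^ n = 2 ^ m * 2 ^ m\<close>, so it consists of \<open>2 ^ m\<close>
  blocks of length \<open>2 ^ m\<close>; the list \<open>[0..<2 ^ m - 1]\<close> ends with the index \<open>2 ^ m - 2\<close>.\<close>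

primrec CS :: "nat \<Rightarrow> word" where
  "CS 0 = [False]"
| "CS (Suc k) =
    (let n = 2 ^ Suc k; m = 2 ^ k;
         x = block (2 ^ m) ((mu ^^ n) [False]);
         y = block (2 ^ m) ((mu ^^ n) [True])
     in concat (map (\<lambda>i. if even i then x i
                         else if x i = y (i + 1) then x i
                         else CS k) [0..<2 ^ m - 1]))"

end

theory Submission
  imports Defs
begin

text \<open>Put \<open>m = 2 ^ k\<close>, \<open>N = 2 ^ m\<close>, and let \<open>t = (mu ^^ m) [False]\<close>. The blocks of the two
  words of length \<open>N * N\<close> are \<open>(mu ^^ m) [t\<^sub>i]\<close> and \<open>(mu ^^ m) [\<not> t\<^sub>i]\<close>, so
  \<open>CS (k + 1)\<close> replaces a block only at indices with \<open>t\<^sub>i = t\<^sub>i\<^sub>+\<^sub>1\<close>. Applying \<open>mu\<close> turns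
  unequal neighbours into equal ones and conversely, while creating an unequal pair inside each
  image of a letter; hence the number \<open>e\<close> of equal neighbours in \<open>t\<close> satisfies
  \<open>3 * e \<le> N - 1\<close>. The deficits \<open>D k = 2 ^ 2 ^ k - |CS k|\<close> therefore obey
  \<open>D (k + 1) \<le> N + (N - 1) / 3 * D k\<close>, and the bound \<open>D k \<le> 2 * N / m\<close> propagates
  because \<open>3 * m \<le> 2 ^ m + 2\<close>.\<close>

declare CS.simps(2) [simp del]

lemma mu_Nil [simp]: "mu [] = []"
  by (simp add: mu_def)

lemma mu_Cons: "mu (b # w) = b # (\<not> b) # mu w"
  by (simp add: mu_def)

lemma mu_append: "mu (u @ v) = mu u @ mu v"
  by (simp add: mu_def)

lemma length_mu [simp]: "length (mu w) = 2 * length w"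
  by (induction w) (simp_all add: mu_Cons)

lemma map_Not_mu: "map Not (mu w) = mu (map Not w)"
  by (induction w) (simp_all add: mu_Cons)

lemma funpow_mu_append: "(mu ^^ m) (u @ v) = (mu ^^ m) u @ (mu ^^ m) v"
  by (induction m) (simp_all add: mu_append)

lemma length_funpow_mu [simp]: "length ((mu ^^ m) w) = 2 ^ m * length w"
  by (induction m) simp_all

lemma map_Not_funpow_mu: "map Not ((mu ^^ m) w) = (mu ^^ m) (map Not w)"
  by (induction m) (simp_all add: map_Not_mu)

lemma block_funpow_mu:
  assumes "i < length w"
  shows "block (2 ^ m) ((mu ^^ m) w) i = (mu ^^ m) [w ! i]"
proof -
  have "w = take i w @ [w ! i] @ drop (Suc i) w"
    using assms by (simp add: id_take_nth_drop)
  then have "(mu ^^ m) w = (mu ^^ m) (take i w) @ (mu ^^ m) [w ! i] @ (mu ^^ m) (drop (Suc i) w)"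
    by (metis funpow_mu_append)
  then show ?thesis
    using assms by (simp add: block_def mult.commute)
qed

fun equal_neighbours :: "'a list \<Rightarrow> nat" where
  "equal_neighbours (a # b # w) = of_bool (a = b) + equal_neighbours (b # w)"
| "equal_neighbours _ = 0"

lemma equal_neighbours_conv_sum:
  "equal_neighbours w = (\<Sum>i<length w - 1. of_bool (w ! i = w ! Suc i))"
  by (induction w rule: equal_neighbours.induct)
    (simp_all add: sum.lessThan_Suc_shift del: sum.lessThan_Suc)

text \<open>The images of adjacent letters \<open>a\<close>, \<open>b\<close> meet in the pair
  \<open>\<not> a\<close>, \<open>b\<close>, which is equal exactly when
  \<open>a \<noteq> b\<close>.\<close>

lemma equal_neighbours_mu:
  "w \<noteq> [] \<Longrightarrow> equal_neighbours (mu w) + equal_neighbours w + 1 = length w"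
  by (induction w rule: equal_neighbours.induct) (auto simp: mu_Cons)

text \<open>Since the count for \<open>mu w\<close> is \<open>length w - 1\<close> minus the count
  for \<open>w\<close>, each of the two bounds yields the other at the next step; neither is
  inductive alone.\<close>

lemma equal_neighbours_funpow_mu:
  "3 * equal_neighbours ((mu ^^ m) [b]) + 1 \<le> 2 ^ m \<and>
   2 ^ m \<le> 3 * equal_neighbours ((mu ^^ m) [b]) + 2"
proof (induction m)
  case (Suc m)
  have "length ((mu ^^ m) [b]) > 0"
    by simp
  then have "(mu ^^ m) [b] \<noteq> []"
    by (rule length_greater_0_conv [THEN iffD1])
  from equal_neighbours_mu [OF this] Suc.IH show ?case
    by simp
qed simp

lemma length_CS_Suc_ge:
  fixes d :: real
  assumes "d \<ge> 0" and N: "N = 2 ^ 2 ^ k" and CS: "real (length (CS k)) \<ge> real N - d"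
  shows "3 * (real N * real N - real (length (CS (Suc k)))) \<le> 3 * real N + (real N - 1) * d"
proof -
  define m :: nat where "m = 2 ^ k"
  define t where "t b = (mu ^^ m) [b]" for b
  define x where "x = block (2 ^ m) ((mu ^^ 2 ^ Suc k) [False])"
  define y where "y = block (2 ^ m) ((mu ^^ 2 ^ Suc k) [True])"
  define c where "c i = (if even i then x i else if x i = y (i + 1) then x i else CS k)" for i
  have Nm: "N = 2 ^ m"
    by (simp add: N m_def)
  have "(mu ^^ 2 ^ Suc k) [b] = (mu ^^ m) (t b)" for b
    by (simp add: m_def t_def mult_2 funpow_add)
  then have xy: "x i = (mu ^^ m) [t False ! i]" "y i = (mu ^^ m) [t True ! i]" if "i < N" for i
    using that by (simp_all add: x_def y_def block_funpow_mu Nm t_def)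
  have "t True = map Not (t False)"
    by (simp add: t_def map_Not_funpow_mu)
  then have t: "t True ! i = (\<not> t False ! i)" if "i < N" for i
    using that by (simp add: t_def Nm)
  \<comment> \<open>The loss \<open>d\<close> is charged at every equal pair, whatever the parity of
    \<open>i\<close>; this only weakens the bound.\<close>
  have c_ge: "real (length (c i)) \<ge> real N - d * of_bool (t False ! i = t False ! Suc i)"
    if "i < N - 1" for i
  proof (cases "c i = x i")
    case True
    with that xy(1) [of i] show ?thesis
      using \<open>d \<ge> 0\<close> by (simp add: Nm)
  next
    case False
    then have "x i \<noteq> y (Suc i)" and "c i = CS k"
      by (auto simp: c_def split: if_splits)
    moreover have "i < N" "Suc i < N"
      using that by simp_all
    ultimately have "t False ! i = t False ! Suc i"
      using xy(1) [of i] xy(2) [of "Suc i"] t [of "Suc i"] by metis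
    with \<open>c i = CS k\<close> show ?thesis
      using CS by simp
  qed
  have "real (equal_neighbours (t False)) = (\<Sum>i<N - 1. of_bool (t False ! i = t False ! Suc i))"
    by (simp add: equal_neighbours_conv_sum t_def Nm)
  moreover have "CS (Suc k) = concat (map c [0..<N - 1])"
    by (simp only: CS.simps Let_def c_def [abs_def] x_def y_def Nm m_def)
  then have "length (CS (Suc k)) = (\<Sum>i<N - 1. length (c i))"
    by (simp add: length_concat comp_def interv_sum_list_conv_sum_set_nat atLeast0LessThan)
  moreover have "(\<Sum>i<N - 1. real N - d * of_bool (t False ! i = t False ! Suc i))
      \<le> (\<Sum>i<N - 1. real (length (c i)))"
    by (intro sum_mono c_ge) simp
  \<comment> \<open>Only \<open>N - 1\<close> blocks are kept, so the missing last one costs a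
    further \<open>N\<close> against \<open>N * N\<close>.\<close>
  ultimately have len: "real (length (CS (Suc k)))
      \<ge> (real N - 1) * real N - d * real (equal_neighbours (t False))"
    by (simp add: sum_subtractf sum_distrib_left [symmetric] of_nat_diff Nm)
  have "3 * real (equal_neighbours (t False)) \<le> real N - 1"
    using equal_neighbours_funpow_mu [of m False] unfolding t_def Nm by linarith
  then have "d * (3 * real (equal_neighbours (t False))) \<le> d * (real N - 1)"
    using \<open>d \<ge> 0\<close> by (rule mult_left_mono)
  with len show ?thesis
    by (simp add: algebra_simps)
qed

lemma three_mult_le_power2: "3 * m \<le> 2 ^ m + (2 :: nat)"
proof -
  consider "m = 0" | "m = 1" | j where "m = Suc (Suc j)"
    by (metis One_nat_def not0_implies_Suc)
  then show ?thesis
  proof cases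
    case 3
    \<comment> \<open>From \<open>j + 1 \<le> 2 ^ j\<close>, multiplied by 4.\<close>
    moreover have "4 + 3 * j \<le> 4 * 2 ^ j"
      using less_exp [of j] by linarith
    ultimately show ?thesis
      by simp
  qed simp_all
qed

lemma length_CS_ge: "real (length (CS k)) \<ge> 2 ^ 2 ^ k - 2 * 2 ^ 2 ^ k / 2 ^ k"
proof (induction k)
  case (Suc k)
  define m N :: real where "m = 2 ^ k" and "N = 2 ^ 2 ^ k"
  have "m > 0" "N > 0"
    by (simp_all add: m_def N_def)
  have "3 * (N * N - real (length (CS (Suc k)))) \<le> 3 * N + (N - 1) * (2 * N / m)"
    using length_CS_Suc_ge [of "2 * N / m" "2 ^ 2 ^ k" k] Suc.IH
    by (simp add: m_def N_def)
  also have "\<dots> = N / m * (3 * m + 2 * N - 2)"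
    using \<open>m > 0\<close> by (simp add: field_simps)
  \<comment> \<open>With \<open>N / m\<close> factored out, exactly \<open>3 * m \<le> N + 2\<close>
    remains.\<close>
  also have "\<dots> \<le> N / m * (3 * N)"
  proof (rule mult_left_mono)
    have "real (3 * 2 ^ k) \<le> real (2 ^ 2 ^ k + 2)"
      using three_mult_le_power2 [of "2 ^ k"] by (simp only: of_nat_le_iff)
    then show "3 * m + 2 * N - 2 \<le> 3 * N"
      by (simp add: m_def N_def)
  qed (use \<open>m > 0\<close> \<open>N > 0\<close> in simp)
  finally have "N * N - N * N / m \<le> real (length (CS (Suc k)))"
    by simp
  moreover have "2 ^ 2 ^ Suc k = N * N" and "2 ^ Suc k = 2 * m"
    by (simp_all add: m_def N_def mult_2 [of "2 ^ k :: nat"] power_add)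
  ultimately show ?case
    by simp
qed simp

theorem theorem1:
  fixes k n :: nat
  assumes "n = 2 ^ k"
  shows "real (length (CS k)) \<ge> 2 ^ n * (1 - 1 / (real n / 2)) \<and>
    2 ^ n * (1 - 1 / (real n / 2)) = 2 ^ (2 ^ k) * (1 - 1 / (2::real) powi (int k - 1))"
proof
  show "real (length (CS k)) \<ge> 2 ^ n * (1 - 1 / (real n / 2))"
    using length_CS_ge [of k] assms by (simp add: algebra_simps)
  \<comment> \<open>At \<open>k = 0\<close> the exponent is -1, hence the integer power.\<close>
  show "2 ^ n * (1 - 1 / (real n / 2)) = 2 ^ (2 ^ k) * (1 - 1 / (2::real) powi (int k - 1))"
    using assms by (simp add: power_int_diff)
qed

end
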